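(* Let $q$ be a prime power and $m,k,n$ positive integers with $k\le n$. Let $\mathcal{C}$ be a nondegenerate $[n,k]_{q^m/q}$ code and let $\mathcal{U}$ be an $[n,k]_{q^m/q}$ system associated with $\mathcal{C}$. Let $h,r$ be integers with $0\le h<k$ and $h\le r\le n-k+h-1$. Then the following are equivalent: (1) $\mathcal{U}$ is $(h,r)$-evasive; (2) $d_{\mathrm{rk},k-h}(\mathcal{C})\ge n-r$; (3) $d_{\mathrm{rk},r-h+1}(\mathcal{C}^\perp)\ge r+2$. Moreover, $d_{\mathrm{rk},k-h}(\mathcal{C})=n-r$ if and only if $\mathcal{U}$ is $(h,r)$-evasive but not $(h,r-1)$-evasive, if and only if $d_{\mathrm{rk},r-h+1}(\mathcal{C}^\perp)\ge r+2\ge d_{\mathrm{rk},r-h}(\mathcal{C}^\perp)+2$ (with the convention $d_{\mathrm{rk},0}(\mathcal{C}^\perp)=0$).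
   Context: For $v=(v_1,\dots,v_n)\in\mathbb{F}_{q^m}^n$, the rank weight is $\mathrm{wt}_{\mathrm{rk}}(v)=\dim_{\mathbb{F}_q}\langle v_1,\dots,v_n\rangle_{\mathbb{F}_q}$. An $[n,k]_{q^m/q}$ code is a $k$-dimensional $\mathbb{F}_{q^m}$-subspace $\mathcal{C}\subseteq\mathbb{F}_{q^m}^n$; its minimum rank distance $d_{\mathrm{rk}}(\mathcal{C})$ is the least rank weight of a nonzero codeword. A generator matrix is $G\in\mathbb{F}_{q^m}^{k\times n}$ whose rows span $\mathcal{C}$. The dual code is $\mathcal{C}^\perp=\{v\in\mathbb{F}_{q^m}^n: cv^\top=0\ \forall c\in\mathcal{C}\}$. $\mathcal{C}$ is nondegenerate if the $\mathbb{F}_q$-span of the columns of a generator matrix has $\mathbb{F}_q$-dimension $n$. An $\mathbb{F}_{q^m}$-subspace $\mathcal{A}\subseteq\mathbb{F}_{q^m}^n$ is Galois closed if it is mapped to itself by the coordinatewise $q$-Frobenius map. For $1\le s\le \dim_{\mathbb{F}_{q^m}}\mathcal{C}$, the $s$-th generalized rank weight is $d_{\mathrm{rk},s}(\mathcal{C})=\min\{\dim_{\mathbb{F}_{q^m}}\mathcal{A}: \mathcal{A}\text{ Galois closed}, \dim_{\mathbb{F}_{q^m}}(\mathcal{A}\cap\mathcal{C})\ge s\}$. An $[n,k]_{q^m/q}$ system is an $n$-dimensional $\mathbb{F}_q$-subspace $\mathcal{U}$ of $\mathbb{F}_{q^m}^k$ whose $\mathbb{F}_{q^m}$-span is $\mathbb{F}_{q^m}^k$.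 If $G$ is a generator matrix of a nondegenerate code $\mathcal{C}$ with columns $g_1,\dots,g_n\in\mathbb{F}_{q^m}^k$, the systems associated with $\mathcal{C}$ are the images $\langle g_1,\dots,g_n\rangle_{\mathbb{F}_q}\cdot M$, $M\in\mathrm{GL}(k,q^m)$ (this class does not depend on the choice of $G$). For integers $0\le h<k$ and $r$, a system $\mathcal{U}$ is $(h,r)$-evasive if $\dim_{\mathbb{F}_q}(\mathcal{U}\cap W)\le r$ for every $h$-dimensional $\mathbb{F}_{q^m}$-subspace $W$ of $\mathbb{F}_{q^m}^k$. *)

theory Defs
  imports "HOL-Analysis.Cartesian_Space"
begin

text \<open>
  The extension of \<open>F_q\<close> by \<open>F_{q^m}\<close> is rendered by two finite field types
  \<open>'f\<close> and \<open>'a\<close> and a field homomorphism \<open>\<iota> :: 'f \<Rightarrow> 'a\<close> (automatically injective).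
  Spaces over \<open>F_{q^m}\<close> use the library interpretation \<open>vec\<close>; spaces over \<open>F_q\<close> use the
  library locales at the scalar multiplication restricted along \<open>\<iota>\<close>.
\<close>

locale field_embedding =
  fixes \<iota> :: "'f::field \<Rightarrow> 'a::field"
  assumes emb_one: "\<iota> 1 = 1"
    and emb_add: "\<iota> (x + y) = \<iota> x + \<iota> y"
    and emb_mult: "\<iota> (x * y) = \<iota> x * \<iota> y"

definition base_scale :: "('f::field \<Rightarrow> 'a::field) \<Rightarrow> 'f \<Rightarrow> 'a^'n \<Rightarrow> 'a^'n"
  where "base_scale \<iota> c v = \<iota> c *s v"

lemma (in field_embedding) vector_space_base_scale:
  "vector_space (base_scale \<iota> :: 'f \<Rightarrow> 'a^'n \<Rightarrow> 'a^'n)"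
  by unfold_locales
    (simp_all add: base_scale_def emb_one emb_add emb_mult
      vec.scale_right_distrib vec.scale_left_distrib)

abbreviation base_subspace :: "('f::field \<Rightarrow> 'a::field) \<Rightarrow> ('a^'n) set \<Rightarrow> bool"
  where "base_subspace \<iota> \<equiv> module.subspace (base_scale \<iota>)"

abbreviation base_span :: "('f::field \<Rightarrow> 'a::field) \<Rightarrow> ('a^'n) set \<Rightarrow> ('a^'n) set"
  where "base_span \<iota> \<equiv> module.span (base_scale \<iota>)"

abbreviation base_dim :: "('f::field \<Rightarrow> 'a::field) \<Rightarrow> ('a^'n) set \<Rightarrow> nat"
  where "base_dim \<iota> \<equiv> vector_space.dim (base_scale \<iota>)"

definition linear_code :: "nat \<Rightarrow> ('a::field^'n) set \<Rightarrow> bool"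
  where "linear_code k C \<longleftrightarrow> vec.subspace C \<and> vec.dim C = k"

definition generator_matrix :: "'a::field^'n^'k \<Rightarrow> ('a^'n) set \<Rightarrow> bool"
  where "generator_matrix G C \<longleftrightarrow> vec.span (rows G) = C"

definition dual_code :: "('a::field^'n) set \<Rightarrow> ('a^'n) set"
  where "dual_code C = {v. \<forall>c\<in>C. (\<Sum>i\<in>UNIV. c $ i * v $ i) = 0}"

text \<open>
  The argument of type \<open>'k itself\<close> only fixes the type indexing the rows of the generator
  matrix; it is meant to be used with \<open>CARD('k)\<close> equal to the dimension of \<open>C\<close>.
\<close>

definition nondegenerate ::
    "('f::field \<Rightarrow> 'a::field) \<Rightarrow> 'k::finite itself \<Rightarrow> ('a^'n) set \<Rightarrow> bool"
  where "nondegenerate \<iota> _ C \<longleftrightarrow>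
    (\<exists>G :: 'a^'n^'k. generator_matrix G C \<and> base_dim \<iota> (base_span \<iota> (columns G)) = CARD('n))"

definition frobenius_vec :: "nat \<Rightarrow> 'a::field^'n \<Rightarrow> 'a^'n"
  where "frobenius_vec q v = (\<chi> i. v $ i ^ q)"

definition galois_closed :: "nat \<Rightarrow> ('a::field^'n) set \<Rightarrow> bool"
  where "galois_closed q A \<longleftrightarrow> vec.subspace A \<and> frobenius_vec q ` A = A"

text \<open>
  For \<open>1 \<le> s \<le> vec.dim C\<close> over a finite field the set below is finite and nonempty. The value
  at \<open>s = 0\<close> is the usual convention (and agrees with the minimum).
\<close>

definition gen_rank_weight :: "nat \<Rightarrow> nat \<Rightarrow> ('a::field^'n) set \<Rightarrow> nat"
  where "gen_rank_weight q s C =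
    (if s = 0 then 0 else Min {vec.dim A | A. galois_closed q A \<and> s \<le> vec.dim (A \<inter> C)})"

definition rank_system :: "('f::field \<Rightarrow> 'a::field) \<Rightarrow> nat \<Rightarrow> ('a^'k) set \<Rightarrow> bool"
  where "rank_system \<iota> n U \<longleftrightarrow>
    base_subspace \<iota> U \<and> base_dim \<iota> U = n \<and> vec.span U = UNIV"

definition associated_system ::
    "('f::field \<Rightarrow> 'a::field) \<Rightarrow> ('a^'n) set \<Rightarrow> ('a^'k) set \<Rightarrow> bool"
  where "associated_system \<iota> C U \<longleftrightarrow>
    (\<exists>(G :: 'a^'n^'k) (M :: 'a^'k^'k). generator_matrix G C \<and> invertible M \<and>
       U = (\<lambda>u. u v* M) ` base_span \<iota> (columns G))"

text \<open>The bound \<open>r\<close> is an integer, so that \<open>(0, -1)\<close>-evasiveness is meaningful (and false).\<close>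

definition evasive :: "('f::field \<Rightarrow> 'a::field) \<Rightarrow> nat \<Rightarrow> int \<Rightarrow> ('a^'k) set \<Rightarrow> bool"
  where "evasive \<iota> h r U \<longleftrightarrow>
    (\<forall>W. vec.subspace W \<and> vec.dim W = h \<longrightarrow> int (base_dim \<iota> (U \<inter> W)) \<le> r)"

end

theory Submission
  imports Defs "HOL-Computational_Algebra.Polynomial"
begin

text \<open>
  Write \<open>F = F_q\<close>, \<open>K = F_{q^m}\<close> and let \<open>H\<close> be a generator matrix of \<open>C\<close> with \<open>U = H F^n\<close>; the kernel of
  \<open>H\<close> on \<open>K^n\<close> is the dual code. By Galois descent the Galois closed spaces are the \<open>K\<close>-spans of
  subspaces of \<open>F^n\<close>. An \<open>h\<close>-dimensional \<open>W\<close> meeting \<open>U\<close> in dimension at least \<open>s\<close> therefore amounts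
  to a Galois closed \<open>B\<close> of dimension \<open>s\<close> whose image under \<open>H\<close> has dimension at most \<open>h\<close>, i.e.,
  by rank-nullity, with \<open>dim (B \<inter> C\<^sup>\<bottom>) \<ge> s - h\<close>. Passing to \<open>A = B\<^sup>\<bottom>\<close> turns this
  into \<open>dim A = n - s\<close> and \<open>dim (A \<inter> C) \<ge> k - h\<close>. Since Galois closed spaces can be enlarged to any
  dimension, the generalized rank weights of \<open>C\<close> and \<open>C\<^sup>\<bottom>\<close> detect exactly these spaces.
  The values \<open>s = r + 1\<close> and \<open>s = r\<close> give all the equivalences.
\<close>

subsection \<open>Linear algebra over a field\<close>

text \<open>A basis of the span of \<open>V\<close> is completed to one of the whole space; any
  \<open>d\<close> of its vectors that include the first basis span a suitable
  \<open>W\<close>.\<close>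

lemma exists_superspace_dim:
  fixes V :: "('a::field^'n) set"
  assumes "vec.dim V \<le> d" "d \<le> CARD('n)"
  obtains W where "vec.subspace W" "vec.dim W = d" "V \<subseteq> W"
proof -
  obtain B where B: "B \<subseteq> V" "vec.independent B" "V \<subseteq> vec.span B" "card B = vec.dim V"
    using vec.basis_exists by metis
  obtain B' where B': "B \<subseteq> B'" "vec.independent B'" "UNIV \<subseteq> vec.span B'"
    using vec.maximal_independent_subset_extend[OF subset_UNIV B(2)] by metis
  have "card B' = CARD('n)"
    using B' vec.dim_eq_card[of B' UNIV] by (simp add: card_cart_basis top.extremum_uniqueI)
  then obtain S where S: "B \<subseteq> S" "S \<subseteq> B'" "card S = d"
    using exists_subset_between[of B d B'] assms B B' vec.finiteI_independent by metis
  show ?thesis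
  proof
    show "vec.dim (vec.span S) = d"
      using S B'(2) vec.dim_span_eq_card_independent vec.independent_mono by metis
    show "V \<subseteq> vec.span S"
      using B(3) S(1) vec.span_mono by blast
  qed (rule vec.subspace_span)
qed

text \<open>Rank-nullity on \<open>S\<close>: the basis vectors of \<open>S\<close> outside a basis
  of the kernel part span a complement \<open>?T\<close>, on which \<open>H\<close> is injective
  with the same image as on \<open>S\<close>.\<close>

lemma dim_image_kernel:
  fixes H :: "'a::field^'n^'m"
  assumes S: "vec.subspace S"
  shows "vec.dim ((*v) H ` S) + vec.dim (S \<inter> {x. H *v x = 0}) = vec.dim S"
proof -
  let ?N = "S \<inter> {x. H *v x = 0}"
  have N: "vec.subspace ?N"
    using S vec.subspace_kernel[of H] by (rule vec.subspace_inter)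
  obtain B where B: "B \<subseteq> ?N" "vec.independent B" "?N \<subseteq> vec.span B" "card B = vec.dim ?N"
    using vec.basis_exists by metis
  obtain C where C: "B \<subseteq> C" "C \<subseteq> S" "vec.independent C" "S \<subseteq> vec.span C"
    using vec.maximal_independent_subset_extend[of B S] B by blast
  have fin: "finite C"
    using C(3) vec.finiteI_independent by blast
  let ?T = "vec.span (C - B)"
  have spanB: "vec.span B = ?N"
    using B(1,3) N by (meson subset_antisym vec.span_minimal)
  have spanC: "vec.span C = S"
    using C(2,4) S by (meson subset_antisym vec.span_minimal)
  have sum: "S = {x + y |x y. x \<in> ?N \<and> y \<in> ?T}"
    using vec.span_Un[of B "C - B"] C(1) by (simp add: spanB spanC Un_absorb1)
  have "vec.dim ?T = card (C - B)"
    using C(3) by (meson Diff_subset vec.dim_span_eq_card_independent vec.independent_mono)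
  moreover have "vec.dim S = card C"
    using C(3) spanC vec.dim_span_eq_card_independent by metis
  ultimately have dims: "vec.dim S = vec.dim ?N + vec.dim ?T"
    using B(4) C(1) fin card_mono[OF fin C(1)] by (simp only: card_Diff_subset finite_subset)
  \<comment> \<open>The dimensions of \<open>?N\<close> and \<open>?T\<close> already add up to that
    of their sum \<open>S\<close>.\<close>
  have "vec.dim (?N \<inter> ?T) = 0"
    using vec.dim_sums_Int[OF N vec.subspace_span[of "C - B"]] dims
    unfolding sum[symmetric] by linarith
  then have triv: "?N \<inter> ?T \<subseteq> {0}"
    by simp
  have TS: "?T \<subseteq> S"
    using spanC by (metis Diff_subset vec.span_mono)
  have "inj_on ((*v) H) ?T"
    using triv TS by (subst vec.linear_inj_on_iff_eq_0) auto
  then have "vec.dim ((*v) H ` ?T) = vec.dim ?T"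
    by (intro vec.dim_image_eq) (simp_all only: vec.span_span matrix_vector_mul_linear_gen)
  moreover have "(*v) H ` S = (*v) H ` ?T"
  proof
    show "(*v) H ` S \<subseteq> (*v) H ` ?T"
    proof safe
      fix x assume "x \<in> S"
      then obtain y z where yz: "x = y + z" "y \<in> ?N" "z \<in> ?T"
        by (subst (asm) sum) blast
      then have "H *v x = H *v z"
        by (simp add: matrix_vector_right_distrib)
      with yz show "H *v x \<in> (*v) H ` ?T" by blast
    qed
  qed (use TS in blast)
  ultimately show ?thesis
    using dims by simp
qed

section \<open>Dual codes\<close>

lemma subspace_dual_code: "vec.subspace (dual_code A)"
  by (auto simp: vec.subspace_def dual_code_def algebra_simps sum.distrib
      simp flip: sum_distrib_left)

lemma dual_code_span: "dual_code (vec.span A) = dual_code A"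
proof
  show "dual_code A \<subseteq> dual_code (vec.span A)"
  proof (clarsimp simp: dual_code_def)
    fix v c :: "'a^'b"
    assume v: "\<forall>c\<in>A. (\<Sum>i\<in>UNIV. c $ i * v $ i) = 0" and "c \<in> vec.span A"
    from this(2) show "(\<Sum>i\<in>UNIV. c $ i * v $ i) = 0"
    proof (induction rule: vec.span_induct_alt)
      case (step a x y)
      have "(\<Sum>i\<in>UNIV. (a *s x + y) $ i * v $ i)
          = a * (\<Sum>i\<in>UNIV. x $ i * v $ i) + (\<Sum>i\<in>UNIV. y $ i * v $ i)"
        by (simp add: sum_distrib_left sum.distrib algebra_simps)
      then show ?case
        using step v by simp
    qed simp
  qed
qed (auto simp: dual_code_def vec.span_base)

lemma dual_code_rows: "dual_code (rows H) = {x. H *v x = 0}"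
  by (auto simp: dual_code_def rows_def row_def matrix_vector_mult_def vec_eq_iff)

text \<open>The form may be isotropic, so \<open>A\<close> need not be complementary to its dual.
  Instead, a basis of \<open>A\<close> is completed to one of the whole space; the matrix
  \<open>P\<close> with these rows is invertible and carries the dual onto a coordinate
  subspace.\<close>

lemma dim_dual_code:
  fixes A :: "('a::field^'n) set"
  shows "vec.dim A + vec.dim (dual_code A) = CARD('n)"
proof -
  obtain B where B: "B \<subseteq> A" "vec.independent B" "A \<subseteq> vec.span B" "card B = vec.dim A"
    using vec.basis_exists by metis
  obtain T where T: "B \<subseteq> T" "vec.independent T" "UNIV \<subseteq> vec.span T"
    using vec.maximal_independent_subset_extend[OF subset_UNIV B(2)] by metis
  have "card T = CARD('n)"
    using T vec.dim_eq_card[of T UNIV] by (simp add: card_cart_basis top.extremum_uniqueI)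
  then obtain e where e: "bij_betw e (UNIV :: 'n set) T"
    using T(2) vec.finiteI_independent by (metis finite_code finite_same_card_bij)
  define P where "P = (\<chi> i. e i)"
  have P: "row i P = e i" for i
    by (simp add: P_def row_def vec_eq_iff)
  have "rows P = T"
    using e by (auto simp: rows_def P bij_betw_def)
  then have "vec.span (rows P) = UNIV"
    using T(3) by auto
  then obtain Q where Q: "Q ** P = mat 1"
    using matrix_left_invertible_span_rows_gen by blast
  then have "P ** Q = mat 1"
    using matrix_left_right_inverse by blast
  then have surj: "surj ((*v) P)"
    using matrix_right_invertible_surjective by blast
  have inj: "inj ((*v) P)"
    using Q matrix_left_invertible_injective by blast
  \<comment> \<open>The rows of \<open>P\<close> that come from \<open>A\<close>: orthogonality to
    \<open>A\<close> is the vanishing of exactly these coordinates of \<open>P *v x\<close>.\<close>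
  define I where "I = e -` B"
  have eI: "e ` I = B"
    using e T(1) by (auto simp: I_def bij_betw_def)
  have "card I = card B"
    using e eI by (metis bij_betw_imp_inj_on card_image inj_on_subset subset_UNIV)
  have dual: "dual_code A = {x. \<forall>i\<in>I. (P *v x) $ i = 0}"
  proof -
    have "vec.span A = vec.span B"
      using B(1,3) by (metis subset_antisym vec.span_minimal vec.span_mono vec.subspace_span)
    then have "dual_code A = dual_code (e ` I)"
      by (metis dual_code_span eI)
    then show ?thesis
      by (auto simp: dual_code_def matrix_vector_mult_def P_def)
  qed
  have "(*v) P ` dual_code A = {y. \<forall>i. i \<notin> - I \<longrightarrow> y $ i = 0}"
  proof safe
    fix y :: "'a^'n" assume y: "\<forall>i. i \<notin> - I \<longrightarrow> y $ i = 0"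
    obtain x where "y = P *v x"
      using surj by blast
    with y show "y \<in> (*v) P ` dual_code A"
      by (auto simp: dual)
  qed (auto simp: dual)
  then have "vec.dim ((*v) P ` dual_code A) = card (- I)"
    by (simp only: dim_substandard_cart)
  moreover have "vec.dim ((*v) P ` dual_code A) = vec.dim (dual_code A)"
    by (rule vec.dim_image_eq[OF matrix_vector_mul_linear_gen inj_on_subset[OF inj subset_UNIV]])
  moreover have "card (- I) + card I = CARD('n)"
    using card_mono[of UNIV I] by (simp add: Compl_eq_Diff_UNIV card_Diff_subset)
  ultimately show ?thesis
    using B(4) \<open>card I = card B\<close> by simp
qed

lemma dual_dual_code:
  assumes "vec.subspace A"
  shows "dual_code (dual_code A) = A"
proof -
  have "A \<subseteq> dual_code (dual_code A)"
    by (auto simp: dual_code_def mult.commute)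
  moreover have "vec.dim (dual_code (dual_code A)) = vec.dim A"
    using dim_dual_code[of A] dim_dual_code[of "dual_code A"] by simp
  ultimately show ?thesis
    using vec.subspace_dim_equal[OF assms subspace_dual_code] by (metis order_refl)
qed

lemma dual_code_sum:
  assumes "vec.subspace A" "vec.subspace B"
  shows "dual_code {x + y |x y. x \<in> A \<and> y \<in> B} = dual_code A \<inter> dual_code B"
proof -
  have "{x + y |x y. x \<in> A \<and> y \<in> B} = vec.span (A \<union> B)"
    unfolding vec.span_Un assms[THEN vec.span_eq_iff[THEN iffD2]] ..
  then show ?thesis
    by (simp only: dual_code_span) (auto simp only: dual_code_def)
qed

text \<open>The intersection on the left is the dual of the sum of \<open>A\<close> and
  \<open>dual_code C\<close>, so the dimension formula for sums applies. This trades intersections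
  with a code for intersections with its dual.\<close>

lemma dim_dual_code_Int:
  fixes A :: "('a::field^'n) set"
  assumes A: "vec.subspace A" and C: "vec.subspace C"
  shows "vec.dim (dual_code A \<inter> C) + vec.dim A = vec.dim (A \<inter> dual_code C) + vec.dim C"
proof -
  let ?S = "{x + y |x y. x \<in> A \<and> y \<in> dual_code C}"
  have "dual_code A \<inter> C = dual_code ?S"
    unfolding dual_code_sum[OF A subspace_dual_code] dual_dual_code[OF C] ..
  then have "vec.dim ?S + vec.dim (dual_code A \<inter> C) = CARD('n)"
    by (simp only: dim_dual_code)
  then show ?thesis
    using vec.dim_sums_Int[OF A subspace_dual_code, of C] dim_dual_code[of C] by linarith
qed

subsection \<open>Frobenius and Galois descent\<close>

text \<open>Multiplication by a nonzero \<open>x\<close> permutes the nonzero elements, so their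
  product is unchanged by the factor \<open>x ^ (CARD('f) - 1)\<close>; one more \<open>x\<close> on
  both sides gives the exponent \<open>CARD('f)\<close>.\<close>

lemma power_card_field_eq:
  fixes x :: "'f::{field,finite}"
  shows "x ^ CARD('f) = x"
proof (cases "x = 0")
  case False
  have "x * (\<Prod>y\<in>UNIV - {0}. x * y) = x * x ^ (CARD('f) - 1) * \<Prod>(UNIV - {0})"
    by (simp add: prod.distrib mult_ac)
  also have "x * x ^ (CARD('f) - 1) = x ^ CARD('f)"
    by (metis One_nat_def Suc_pred finite_UNIV_card_ge_0 finite power_Suc)
  also have "(\<Prod>y\<in>UNIV - {0}. x * y) = \<Prod>(UNIV - {0})"
    by (rule prod.reindex_bij_witness[of _ "\<lambda>y. y / x" "\<lambda>y. x * y"]) (use False in auto)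
  finally show ?thesis
    by simp
qed simp

lemma card_field_ge_2: "CARD('f::{field,finite}) \<ge> 2"
  using card_mono[of UNIV "{0, 1 :: 'f}"] by simp

context field_embedding
begin

lemma emb_zero: "\<iota> 0 = 0"
  using emb_add[of 0 0] by (metis add_cancel_right_right add_0)

lemma emb_minus: "\<iota> (- x) = - \<iota> x"
  using emb_add[of x "- x"] by (simp add: emb_zero add_eq_0_iff)

lemma emb_diff: "\<iota> (x - y) = \<iota> x - \<iota> y"
  using emb_add[of x "- y"] by (simp add: emb_minus)

lemma emb_eq_0_iff: "\<iota> x = 0 \<longleftrightarrow> x = 0"
proof
  show "x = 0" if "\<iota> x = 0"
    using that emb_mult[of x "inverse x"] by (cases "x = 0") (simp_all add: emb_one)
qed (simp add: emb_zero)

lemma inj_emb: "inj \<iota>"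
  by (rule injI) (metis emb_diff emb_eq_0_iff right_minus_eq)

lemma emb_power: "\<iota> (x ^ j) = \<iota> x ^ j"
  by (induction j) (simp_all add: emb_one emb_mult)

end

section \<open>The q-power map on the extension field\<close>

locale finite_field_embedding = field_embedding \<iota>
  for \<iota> :: "'f::{field,finite} \<Rightarrow> 'a::{field,finite}"
begin

text \<open>This is \<open>X^q - X\<close> in split form, so that its roots are visible;
  \<open>base_poly_eq\<close> supplies the expanded form.\<close>

definition base_poly :: "'a poly"
  where "base_poly = (\<Prod>c\<in>range \<iota>. [:- c, 1:])"

lemma card_range_emb: "card (range \<iota>) = CARD('f)"
  by (simp add: card_image inj_emb)

lemma degree_base_poly: "degree base_poly = CARD('f)"
  by (simp add: base_poly_def degree_prod_eq_sum_degree card_range_emb)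

lemma lead_coeff_base_poly: "lead_coeff base_poly = 1"
  by (simp add: base_poly_def lead_coeff_prod)

lemma poly_base_poly_eq_0_iff: "poly base_poly x = 0 \<longleftrightarrow> x \<in> range \<iota>"
  by (auto simp: base_poly_def poly_prod)

text \<open>Both sides are monic of degree \<open>CARD('f)\<close> and vanish on the
  \<open>CARD('f)\<close> points of \<open>range \<iota>\<close>.\<close>

lemma base_poly_eq: "base_poly = monom 1 CARD('f) - monom 1 1"
proof (rule poly_eqI_degree_lead_coeff[where A = "range \<iota>" and n = "CARD('f)"])
  show "coeff base_poly CARD('f) = coeff (monom 1 CARD('f) - monom 1 1) CARD('f)"
    using lead_coeff_base_poly card_field_ge_2[where 'f = 'f] by (simp add: degree_base_poly)
  show "degree (monom 1 CARD('f) - monom (1::'a) 1) \<le> CARD('f)"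
    using card_field_ge_2[where 'f = 'f] by (intro degree_diff_le) (simp_all add: degree_monom_eq)
  show "poly base_poly z = poly (monom 1 CARD('f) - monom 1 1) z" if "z \<in> range \<iota>" for z
    using that poly_base_poly_eq_0_iff[of z]
    by (auto simp: poly_monom power_card_field_eq simp flip: emb_power)
qed (simp_all add: card_range_emb degree_base_poly)

lemma frobenius_fixed_iff: "(x :: 'a) ^ CARD('f) = x \<longleftrightarrow> x \<in> range \<iota>"
  using poly_base_poly_eq_0_iff[of x] by (simp add: base_poly_eq poly_monom)

text \<open>
  The polynomial \<open>\<Prod>c\<in>F. (X - c) = X^q - X\<close> is invariant under translations by \<open>F\<close>, so for
  fixed \<open>y\<close> its values at \<open>x + y\<close> and \<open>x\<close> differ by a constant at \<open>q\<close> points \<open>x\<close>, hence everywhere;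
  this makes \<open>q\<close>-th powers additive without mentioning the characteristic.
\<close>

lemma frobenius_add: "(x + y :: 'a) ^ CARD('f) = x ^ CARD('f) + y ^ CARD('f)"
proof -
  have "pcompose base_poly [:y, 1:] = base_poly + [:poly base_poly y:]"
  proof (rule poly_eqI_degree_lead_coeff[where A = "range \<iota>" and n = "CARD('f)"])
    have deg: "degree (pcompose base_poly [:y, 1:]) = CARD('f)"
      by (simp add: degree_pcompose degree_base_poly)
    have "lead_coeff (pcompose base_poly [:y, 1:]) = 1"
      by (subst lead_coeff_comp) (simp_all add: lead_coeff_base_poly)
    then show "coeff (pcompose base_poly [:y, 1:]) CARD('f)
        = coeff (base_poly + [:poly base_poly y:]) CARD('f)"
      using lead_coeff_base_poly by (simp add: deg degree_base_poly coeff_pCons split: nat.split)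
    show "poly (pcompose base_poly [:y, 1:]) z = poly (base_poly + [:poly base_poly y:]) z"
      if "z \<in> range \<iota>" for z
    proof -
      obtain c where z: "z = \<iota> c" using \<open>z \<in> range \<iota>\<close> by blast
      have "poly base_poly (y + z) = poly base_poly y"
        unfolding base_poly_def poly_prod
        by (rule prod.reindex_bij_witness[of _ "\<lambda>w. w + z" "\<lambda>w. w - z"])
          (auto simp: z algebra_simps simp flip: emb_diff emb_add)
      moreover have "poly base_poly z = 0"
        using that by (simp add: poly_base_poly_eq_0_iff)
      ultimately show ?thesis by (simp add: poly_pcompose)
    qed
    show "degree (pcompose base_poly [:y, 1:]) \<le> CARD('f)"
      by (simp add: deg)
    show "degree (base_poly + [:poly base_poly y:]) \<le> CARD('f)"
      by (intro degree_add_le) (simp_all add: degree_base_poly)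
  qed (simp add: card_range_emb)
  then have "poly (pcompose base_poly [:y, 1:]) x = poly (base_poly + [:poly base_poly y:]) x"
    by simp
  then have "poly base_poly (x + y) = poly base_poly x + poly base_poly y"
    by (simp add: poly_pcompose add.commute)
  then show ?thesis
    by (simp add: base_poly_eq poly_monom algebra_simps)
qed

lemma frobenius_sum: "(\<Sum>i\<in>I. g i) ^ CARD('f) = (\<Sum>i\<in>I. (g i :: 'a) ^ CARD('f))"
  by (induction I rule: infinite_finite_induct) (simp_all add: frobenius_add power_0_left)

lemma frobenius_diff: "(x - y) ^ CARD('f) = x ^ CARD('f) - (y :: 'a) ^ CARD('f)"
  using frobenius_add[of "x - y" y] by (simp add: eq_diff_eq)

lemma frobenius_eq_iff: "x ^ CARD('f) = y ^ CARD('f) \<longleftrightarrow> x = (y :: 'a)"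
proof
  assume "x ^ CARD('f) = y ^ CARD('f)"
  then have "(x - y) ^ CARD('f) = 0"
    by (simp only: frobenius_diff diff_self)
  then show "x = y" by simp
qed simp

section \<open>Rational vectors and Galois descent\<close>

definition ext_vec :: "'f^'n \<Rightarrow> 'a^'n"
  where "ext_vec v = (\<chi> i. \<iota> (v $ i))"

lemma ext_vec_nth [simp]: "ext_vec v $ i = \<iota> (v $ i)"
  by (simp add: ext_vec_def)

lemma inj_ext_vec: "inj ext_vec"
  using inj_emb by (auto simp: inj_def vec_eq_iff)

lemma card_ext_vec_image: "card (ext_vec ` T) = card T"
  by (rule card_image[OF inj_on_subset[OF inj_ext_vec subset_UNIV]])

lemma ext_vec_add: "ext_vec (u + v) = ext_vec u + ext_vec v"
  by (simp add: vec_eq_iff emb_add)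

lemma ext_vec_scale: "ext_vec (c *s v) = \<iota> c *s ext_vec v"
  by (simp add: vec_eq_iff emb_mult)

lemma ext_vec_zero: "ext_vec 0 = 0"
  by (simp add: vec_eq_iff emb_zero)

lemma ext_vec_axis: "ext_vec (axis i 1) = axis i 1"
  by (simp add: vec_eq_iff axis_def emb_one emb_zero)

lemma frob_nth [simp]: "frobenius_vec CARD('f) v $ i = v $ i ^ CARD('f)"
  by (simp add: frobenius_vec_def)

lemma frob_add:
  "frobenius_vec CARD('f) (u + v :: 'a^'n) = frobenius_vec CARD('f) u + frobenius_vec CARD('f) v"
  by (simp add: vec_eq_iff frobenius_add)

lemma frob_scale:
  "frobenius_vec CARD('f) (c *s v :: 'a^'n) = c ^ CARD('f) *s frobenius_vec CARD('f) v"
  by (simp add: vec_eq_iff power_mult_distrib)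

lemma frob_fixed_iff: "frobenius_vec CARD('f) (v :: 'a^'n) = v \<longleftrightarrow> v \<in> range ext_vec"
proof
  assume "frobenius_vec CARD('f) v = v"
  then have "\<forall>i. \<exists>c. v $ i = \<iota> c"
    by (metis frob_nth frobenius_fixed_iff rangeE)
  then obtain c where "\<And>i. v $ i = \<iota> (c i)" by metis
  then have "v = ext_vec (\<chi> i. c i)" by (simp add: vec_eq_iff)
  then show "v \<in> range ext_vec" by blast
qed (auto simp: vec_eq_iff power_card_field_eq simp flip: emb_power)

lemma inj_frob: "inj (frobenius_vec CARD('f) :: 'a^'n \<Rightarrow> 'a^'n)"
  by (auto simp: inj_def vec_eq_iff frobenius_eq_iff)

text \<open>On a finite set an injective self-map is onto, so invariance already gives
  equality.\<close>

lemma galois_closedI: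
  fixes A :: "('a^'n) set"
  assumes "vec.subspace A" "\<And>v. v \<in> A \<Longrightarrow> frobenius_vec CARD('f) v \<in> A"
  shows "galois_closed CARD('f) A"
proof -
  have "frobenius_vec CARD('f) ` A = A"
    by (rule endo_inj_surj) (use assms(2) inj_on_subset[OF inj_frob] in auto)
  with assms(1) show ?thesis
    by (simp add: galois_closed_def)
qed

lemma ext_vec_span:
  "v \<in> vec.span S \<Longrightarrow> ext_vec v \<in> vec.span (ext_vec ` S)"
proof (induction rule: vec.span_induct_alt)
  case (step c x y)
  then show ?case
    by (simp add: ext_vec_add ext_vec_scale vec.span_add vec.span_scale vec.span_base)
qed (simp add: ext_vec_zero vec.span_zero)

text \<open>Complete \<open>T\<close> to a basis of the base space: its image spans all axis
  vectors, hence everything, and \<open>CARD('n)\<close> spanning vectors are independent.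
  Conversely, a dependence persists under extension of scalars.\<close>

lemma independent_ext_vec_iff:
  "vec.independent (ext_vec ` (T :: ('f^'n) set)) \<longleftrightarrow> vec.independent T"
proof
  assume "vec.independent T"
  then obtain T' where T': "T \<subseteq> T'" "vec.independent T'" "UNIV \<subseteq> vec.span T'"
    using vec.maximal_independent_subset_extend[of T UNIV] by auto
  have "axis i 1 \<in> vec.span (ext_vec ` T')" for i
    using ext_vec_span[of "axis i 1" T'] T' by (auto simp: ext_vec_axis)
  then have "cart_basis \<subseteq> vec.span (ext_vec ` T')"
    by (auto simp: cart_basis_def)
  then have span: "vec.span (ext_vec ` T') = UNIV"
    by (metis span_cart_basis top.extremum_uniqueI vec.span_minimal vec.subspace_span)
  have "card (ext_vec ` T') = CARD('n)"
    using T' vec.dim_eq_card[of T' UNIV]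
    by (simp add: card_ext_vec_image card_cart_basis top.extremum_uniqueI)
  then have "vec.independent (ext_vec ` T')"
    using span vec.card_le_dim_spanning[of "ext_vec ` T'" UNIV]
    by (simp add: card_cart_basis)
  then show "vec.independent (ext_vec ` T)"
    using T'(1) by (meson image_mono vec.independent_mono)
next
  assume ind: "vec.independent (ext_vec ` T)"
  show "vec.independent T"
  proof
    assume "vec.dependent T"
    then obtain t where t: "t \<in> T" "t \<in> vec.span (T - {t})"
      by (auto simp: vec.dependent_def)
    have "ext_vec t \<in> vec.span (ext_vec ` T - {ext_vec t})"
      using ext_vec_span[OF t(2)] by (simp add: image_set_diff[OF inj_ext_vec])
    with ind t(1) show False by (auto simp: vec.dependent_def)
  qed
qed

lemma galois_closed_span:
  fixes S :: "('a^'b) set"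
  assumes "\<And>v. v \<in> S \<Longrightarrow> frobenius_vec CARD('f) v = v"
  shows "galois_closed CARD('f) (vec.span S)"
proof (rule galois_closedI[OF vec.subspace_span])
  fix v assume "v \<in> vec.span S"
  then show "frobenius_vec CARD('f) v \<in> vec.span S"
  proof (induction rule: vec.span_induct_alt)
    case base
    have "frobenius_vec CARD('f) 0 = (0 :: 'a^'b)" by (simp add: vec_eq_iff power_0_left)
    then show ?case by (simp add: vec.span_zero)
  next
    case (step c x y)
    then show ?case
      by (simp add: frob_add frob_scale assms vec.span_add vec.span_scale vec.span_base)
  qed
qed

lemma galois_closed_frob: "galois_closed CARD('f) B \<Longrightarrow> v \<in> B \<Longrightarrow> frobenius_vec CARD('f) v \<in> B"
  by (metis galois_closed_def imageI)

text \<open>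
  Normalise a coordinate of \<open>v\<close> to 1: then \<open>frobenius v - v\<close> has smaller support, and if it is nonzero
  it can be used to clear a further coordinate of \<open>v\<close>.
\<close>

lemma galois_descent:
  fixes B :: "('a^'n) set"
  assumes B: "galois_closed CARD('f) B" and "v \<in> B"
  shows "v \<in> vec.span (B \<inter> range ext_vec)"
  using \<open>v \<in> B\<close>
proof (induction "card {i. v $ i \<noteq> 0}" arbitrary: v rule: less_induct)
  case less
  have sub: "vec.subspace B"
    using B by (simp add: galois_closed_def)
  have smaller: "w \<in> vec.span (B \<inter> range ext_vec)"
    if "w \<in> B" "\<And>i. v $ i = 0 \<Longrightarrow> w $ i = 0" "v $ j \<noteq> 0" "w $ j = 0" for w and j :: 'n
  proof (rule less.hyps[OF _ that(1)])
    show "card {i. w $ i \<noteq> 0} < card {i. v $ i \<noteq> 0}"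
      using that by (intro psubset_card_mono) auto
  qed
  show ?case
  proof (cases "v = 0")
    case False
    then obtain i where i: "v $ i \<noteq> 0" by (auto simp: vec_eq_iff)
    define v' where "v' = inverse (v $ i) *s v"
    have v': "v' \<in> B" "v' $ i = 1" "v = v $ i *s v'"
      using i less.prems sub by (auto simp: v'_def vec.subspace_scale)
    define u where "u = frobenius_vec CARD('f) v' - v'"
    have u: "u \<in> vec.span (B \<inter> range ext_vec)"
    proof (rule smaller[OF _ _ i])
      show "u \<in> B"
        unfolding u_def using v' B sub by (simp add: vec.subspace_diff galois_closed_frob)
      show "u $ j = 0" if "v $ j = 0" for j
        using that by (simp add: u_def v'_def power_0_left)
    qed (simp add: u_def v')
    show ?thesis
    proof (cases "u = 0")
      case True
      \<comment> \<open>Here \<open>v'\<close> is fixed by Frobenius, so it belongs to the spanning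
        set itself.\<close>
      then have "v' \<in> range ext_vec"
        by (simp add: u_def flip: frob_fixed_iff)
      then show ?thesis
        using v' by (metis IntI vec.span_base vec.span_scale)
    next
      case False
      then obtain j where j: "u $ j \<noteq> 0" by (auto simp: vec_eq_iff)
      have supp: "u $ l = 0" if "v $ l = 0" for l
        using that by (simp add: u_def v'_def power_0_left)
      have uB: "u \<in> B"
        unfolding u_def using v' B sub by (simp add: vec.subspace_diff galois_closed_frob)
      have "v - (v $ j / u $ j) *s u \<in> vec.span (B \<inter> range ext_vec)"
      proof (rule smaller[of _ j])
        show "v - (v $ j / u $ j) *s u \<in> B"
          using less.prems uB sub by (simp add: vec.subspace_diff vec.subspace_scale)
      qed (use j supp in auto)
      then have "v - (v $ j / u $ j) *s u + (v $ j / u $ j) *s u \<in> vec.span (B \<inter> range ext_vec)"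
        using u by (intro vec.span_add vec.span_scale)
      then show ?thesis by simp
    qed
  qed (simp add: vec.span_zero)
qed

text \<open>By descent the rational vectors of \<open>B\<close> span it, so a maximal independent
  set of them is a basis; it stays independent when pulled back to the base field.\<close>

lemma galois_closed_rational_basis:
  fixes B :: "('a^'n) set"
  assumes "galois_closed CARD('f) B"
  obtains T :: "('f^'n) set" where "vec.independent T" "vec.span (ext_vec ` T) = B"
    "card T = vec.dim B"
proof -
  obtain S where S: "S \<subseteq> B \<inter> range ext_vec" "vec.independent S" "B \<inter> range ext_vec \<subseteq> vec.span S"
    using vec.maximal_independent_subset by metis
  obtain T where T: "S = ext_vec ` T"
    using S(1) by (metis le_inf_iff subset_image_iff)
  have "B \<subseteq> vec.span S"
  proof
    fix v assume "v \<in> B"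
    then have "v \<in> vec.span (B \<inter> range ext_vec)"
      using assms galois_descent by blast
    then show "v \<in> vec.span S"
      using S(3) by (meson vec.span_minimal vec.subspace_span subset_iff)
  qed
  moreover have "vec.span S \<subseteq> B"
    using S(1) assms by (intro vec.span_minimal) (auto simp: galois_closed_def)
  ultimately have span: "vec.span S = B" by blast
  have "card T = card S"
    by (simp add: T card_ext_vec_image)
  also have "\<dots> = vec.dim B"
    using S(2) span by (metis vec.dim_span_eq_card_independent)
  finally show ?thesis
    using that[of T] S(2) span by (simp add: T independent_ext_vec_iff)
qed


text \<open>Frobenius commutes with the bilinear form, and every vector of \<open>A\<close> is the
  Frobenius image of a vector of \<open>A\<close>.\<close>

lemma galois_closed_dual_code:
  fixes A :: "('a^'n) set"
  assumes "galois_closed CARD('f) A"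
  shows "galois_closed CARD('f) (dual_code A)"
proof (rule galois_closedI[OF subspace_dual_code])
  fix v assume v: "v \<in> dual_code A"
  show "frobenius_vec CARD('f) v \<in> dual_code A"
    unfolding dual_code_def
  proof safe
    fix c assume "c \<in> A"
    then obtain d where d: "d \<in> A" "c = frobenius_vec CARD('f) d"
      using assms by (metis galois_closed_def imageE)
    have "(\<Sum>i\<in>UNIV. c $ i * frobenius_vec CARD('f) v $ i) = (\<Sum>i\<in>UNIV. d $ i * v $ i) ^ CARD('f)"
      by (simp add: d frobenius_sum power_mult_distrib)
    also have "\<dots> = 0"
      using v d(1) by (simp add: dual_code_def power_0_left)
    finally show "(\<Sum>i\<in>UNIV. c $ i * frobenius_vec CARD('f) v $ i) = 0" .
  qed
qed

lemma galois_closed_span_ext_vec: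
  "galois_closed CARD('f) (vec.span (ext_vec ` T))"
  by (rule galois_closed_span) (auto simp: frob_fixed_iff)

lemma dim_span_ext_vec:
  assumes "vec.independent T"
  shows "vec.dim (vec.span (ext_vec ` T)) = card T"
proof -
  have "vec.independent (ext_vec ` T)"
    using assms by (simp add: independent_ext_vec_iff)
  then show ?thesis
    by (metis vec.dim_span_eq_card_independent card_ext_vec_image)
qed

section \<open>Testing generalized rank weights in a fixed dimension\<close>

text \<open>The enlargement happens over the base field: a rational basis of \<open>A\<close> is
  extended there, and only then are scalars extended.\<close>

lemma exists_galois_closed_superspace_dim:
  fixes A :: "('a^'n) set"
  assumes "galois_closed CARD('f) A" "vec.dim A \<le> d" "d \<le> CARD('n)"
  obtains A' where "galois_closed CARD('f) A'" "vec.dim A' = d" "A \<subseteq> A'"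
proof -
  obtain T :: "('f^'n) set" where T: "vec.independent T" "vec.span (ext_vec ` T) = A"
      "card T = vec.dim A"
    using galois_closed_rational_basis assms(1) by metis
  obtain W where W: "vec.subspace W" "vec.dim W = d" "T \<subseteq> W"
    using exists_superspace_dim[of T d] assms T vec.dim_eq_card_independent by metis
  obtain S where S: "T \<subseteq> S" "S \<subseteq> W" "vec.independent S" "W \<subseteq> vec.span S"
    using vec.maximal_independent_subset_extend[OF W(3) T(1)] by metis
  show ?thesis
  proof
    show "galois_closed CARD('f) (vec.span (ext_vec ` S))"
      by (rule galois_closed_span_ext_vec)
    show "vec.dim (vec.span (ext_vec ` S)) = d"
      using S W(2) by (metis dim_span_ext_vec vec.basis_card_eq_dim)
    show "A \<subseteq> vec.span (ext_vec ` S)"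
      using S(1) T(2) by (metis image_mono vec.span_mono)
  qed
qed

text \<open>Enlarging \<open>A\<close> can only enlarge \<open>A \<inter> C\<close>, so a witness of
  dimension at most \<open>t\<close> can be replaced by one of dimension exactly \<open>t\<close>.
  The bounds on \<open>s\<close> exclude the default at \<open>0\<close> and make the minimum range
  over a nonempty set.\<close>

lemma less_gen_rank_weight_iff:
  fixes C :: "('a^'n) set"
  assumes "0 < s" "s \<le> vec.dim C" "t \<le> CARD('n)"
  shows "t < gen_rank_weight CARD('f) s C \<longleftrightarrow>
    \<not> (\<exists>A. galois_closed CARD('f) A \<and> vec.dim A = t \<and> s \<le> vec.dim (A \<inter> C))"
proof -
  let ?X = "{vec.dim A | A. galois_closed CARD('f) A \<and> s \<le> vec.dim (A \<inter> C)}"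
  have fin: "finite ?X" by simp
  have "galois_closed CARD('f) (UNIV :: ('a^'n) set)"
    by (rule galois_closedI) simp_all
  then have ne: "?X \<noteq> {}"
    using assms(2) by (auto intro!: exI[of _ UNIV])
  have "t < gen_rank_weight CARD('f) s C \<longleftrightarrow> (\<forall>x\<in>?X. t < x)"
    using assms(1) fin ne by (simp add: gen_rank_weight_def del: Collect_empty_eq)
  also have "\<dots> \<longleftrightarrow> \<not> (\<exists>A. galois_closed CARD('f) A \<and> vec.dim A = t \<and> s \<le> vec.dim (A \<inter> C))"
  proof
    assume "\<not> (\<exists>A. galois_closed CARD('f) A \<and> vec.dim A = t \<and> s \<le> vec.dim (A \<inter> C))"
    moreover have "\<exists>A'. galois_closed CARD('f) A' \<and> vec.dim A' = t \<and> s \<le> vec.dim (A' \<inter> C)"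
      if A: "galois_closed CARD('f) A" "s \<le> vec.dim (A \<inter> C)" "vec.dim A \<le> t" for A
    proof -
      obtain A' where A': "galois_closed CARD('f) A'" "vec.dim A' = t" "A \<subseteq> A'"
        using exists_galois_closed_superspace_dim[OF A(1,3) assms(3)] by metis
      have "vec.dim (A \<inter> C) \<le> vec.dim (A' \<inter> C)"
        using A'(3) by (intro vec.dim_subset) blast
      with A' A(2) show ?thesis by auto
    qed
    ultimately show "\<forall>x\<in>?X. t < x"
      by (force simp: not_le)
  qed blast
  finally show ?thesis .
qed

subsection \<open>Evasiveness and generalized rank weights\<close>

lemma base_span_columns:
  fixes G :: "'a^'n^'k"
  shows "base_span \<iota> (columns G) = (\<lambda>l. G *v ext_vec l) ` UNIV"
proof -
  interpret bs: vector_space "base_scale \<iota> :: 'f \<Rightarrow> 'a^'k \<Rightarrow> 'a^'k"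
    by (rule vector_space_base_scale)
  let ?R = "range (\<lambda>l. G *v ext_vec l)"
  have "bs.subspace ?R"
  proof (rule bs.subspaceI)
    show "0 \<in> ?R"
      by (rule range_eqI[of _ _ 0]) (simp add: ext_vec_zero)
    show "x + y \<in> ?R" if "x \<in> ?R" "y \<in> ?R" for x y
      using that by (auto simp flip: matrix_vector_right_distrib ext_vec_add)
    show "base_scale \<iota> c x \<in> ?R" if "x \<in> ?R" for c x
      using that by (auto simp: base_scale_def simp flip: vec.scale ext_vec_scale)
  qed
  moreover have "column i G \<in> ?R" for i
    by (rule range_eqI[of _ _ "axis i 1"])
      (simp add: ext_vec_axis, simp add: vec_eq_iff matrix_vector_mult_def column_def axis_def
        if_distrib cong: if_cong)
  ultimately have "bs.span (columns G) \<subseteq> ?R"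
    by (intro bs.span_minimal) (auto simp: columns_def)
  moreover have "G *v ext_vec l \<in> bs.span (columns G)" for l
  proof -
    have "G *v ext_vec l = (\<Sum>i\<in>UNIV. base_scale \<iota> (l $ i) (column i G))"
      by (simp add: matrix_mult_sum base_scale_def)
    also have "\<dots> \<in> bs.span (columns G)"
      by (intro bs.span_sum bs.span_scale bs.span_base) (auto simp: columns_def)
    finally show ?thesis .
  qed
  ultimately show ?thesis by blast
qed

text \<open>Since \<open>U\<close> has full dimension \<open>CARD('n)\<close>, the coordinates
  \<open>l\<close> parametrise it injectively, and dimensions can be counted in the base
  space.\<close>

lemma base_dim_image_Int:
  fixes H :: "'a^'n^'k" and W :: "('a^'k) set"
  defines "U \<equiv> range (\<lambda>l. H *v ext_vec l)"
  assumes dimU: "base_dim \<iota> U = CARD('n)"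
  shows "base_dim \<iota> (U \<inter> W) = vec.dim {l. H *v ext_vec l \<in> W}"
proof -
  interpret bs: vector_space "base_scale \<iota> :: 'f \<Rightarrow> 'a^'k \<Rightarrow> 'a^'k"
    by (rule vector_space_base_scale)
  obtain E :: "('a^'k) set" where E: "bs.independent E" "UNIV \<subseteq> bs.span E"
    using bs.maximal_independent_subset by metis
  interpret bs: finite_dimensional_vector_space "base_scale \<iota> :: 'f \<Rightarrow> 'a^'k \<Rightarrow> 'a^'k" E
    using E by unfold_locales auto
  interpret p: finite_dimensional_vector_space_pair "(*s) :: 'f \<Rightarrow> 'f^'n \<Rightarrow> 'f^'n" cart_basis
      "base_scale \<iota> :: 'f \<Rightarrow> 'a^'k \<Rightarrow> 'a^'k" E
    by unfold_locales
  define \<phi> where "\<phi> = (\<lambda>l. H *v ext_vec l)"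
  have lin: "Vector_Spaces.linear (*s) (base_scale \<iota>) \<phi>"
    by unfold_locales
      (simp_all add: \<phi>_def ext_vec_add ext_vec_scale matrix_vector_right_distrib base_scale_def vec.scale)
  interpret l: Vector_Spaces.linear "(*s)" "base_scale \<iota>" \<phi>
    by (rule lin)
  have span: "U \<subseteq> bs.span (\<phi> ` cart_basis)"
    using l.span_image[of cart_basis] by (simp add: U_def \<phi>_def)
  \<comment> \<open>The images of the \<open>CARD('n)\<close> axis vectors span \<open>U\<close>, so
    by its dimension they are distinct and independent.\<close>
  have "bs.dim U \<le> card (\<phi> ` cart_basis)"
    using span by (intro bs.dim_le_card) (simp_all add: finite_cart_basis)
  then have card: "card (\<phi> ` cart_basis) = CARD('n)"
    using dimU card_image_le[OF finite_cart_basis, of \<phi>] by (simp add: card_cart_basis)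
  have "bs.independent (\<phi> ` cart_basis)"
    using span card dimU
    by (intro bs.card_le_dim_spanning[of _ U]) (auto simp: U_def \<phi>_def finite_cart_basis)
  moreover have "inj_on \<phi> cart_basis"
    using card by (simp add: eq_card_imp_inj_on finite_cart_basis card_cart_basis)
  ultimately have "inj \<phi>"
    using p.linear_inj_on_span_iff_independent_image[OF lin, of cart_basis] by simp
  then have "bs.dim (\<phi> ` {l. \<phi> l \<in> W}) = vec.dim {l. \<phi> l \<in> W}"
    by (intro p.dim_image_eq[OF lin]) (rule inj_on_subset, auto)
  moreover have "U \<inter> W = \<phi> ` {l. \<phi> l \<in> W}"
    by (auto simp: U_def \<phi>_def)
  ultimately show ?thesis
    by (simp add: \<phi>_def)
qed

text \<open>The bound \<open>int s - 1\<close> makes failure mean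
  \<open>s \<le> base_dim \<iota> (U \<inter> W)\<close>, also for \<open>s = 0\<close>. From
  \<open>W\<close>, take \<open>B\<close> spanned by rational vectors that \<open>H\<close> sends
  into \<open>W\<close>; from \<open>B\<close>, take \<open>W\<close> containing its image.
  Rank-nullity on \<open>B\<close> turns the kernel condition into image dimension at most
  \<open>h\<close>.\<close>

lemma not_evasive_iff:
  fixes H :: "'a^'n^'k"
  defines "U \<equiv> range (\<lambda>l. H *v ext_vec l)"
  assumes dimU: "base_dim \<iota> U = CARD('n)" and h: "h \<le> CARD('k)"
  shows "\<not> evasive \<iota> h (int s - 1) U \<longleftrightarrow>
    (\<exists>B. galois_closed CARD('f) B \<and> vec.dim B = s \<and> s \<le> vec.dim (B \<inter> {x. H *v x = 0}) + h)"
    (is "_ \<longleftrightarrow> (\<exists>B. ?P B)")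
proof
  assume "\<not> evasive \<iota> h (int s - 1) U"
  then obtain W where W: "vec.subspace W" "vec.dim W = h" "s \<le> base_dim \<iota> (U \<inter> W)"
    by (auto simp: evasive_def)
  define L where "L = {l. H *v ext_vec l \<in> W}"
  have "s \<le> vec.dim L"
    using W(3) base_dim_image_Int[of H W] dimU by (simp add: U_def L_def)
  moreover obtain T' where T': "T' \<subseteq> L" "vec.independent T'" "card T' = vec.dim L"
    using vec.basis_exists by metis
  \<comment> \<open>Only \<open>s\<close> of the independent vectors are kept, so that the span has
    dimension exactly \<open>s\<close>.\<close>
  ultimately obtain T where T: "T \<subseteq> T'" "card T = s"
    using obtain_subset_with_card_n by metis
  have ind: "vec.independent T"
    using T(1) T'(2) vec.independent_mono by blast
  let ?B = "vec.span (ext_vec ` T)"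
  have "(*v) H ` ext_vec ` T \<subseteq> W"
    using T(1) T'(1) by (auto simp: L_def)
  then have "(*v) H ` ?B \<subseteq> W"
    using W(1) vec.linear_span_image[OF matrix_vector_mul_linear_gen, of H "ext_vec ` T"]
    by (metis vec.span_minimal)
  then have "vec.dim ((*v) H ` ?B) \<le> h"
    using W(2) vec.dim_subset by blast
  then have "?P ?B"
    using dim_image_kernel[OF vec.subspace_span, of H "ext_vec ` T"] T(2)
    using galois_closed_span_ext_vec[of T] dim_span_ext_vec[OF ind] by linarith
  then show "\<exists>B. ?P B" ..
next
  assume "\<exists>B. ?P B"
  then obtain B where B: "galois_closed CARD('f) B" "vec.dim B = s"
      "s \<le> vec.dim (B \<inter> {x. H *v x = 0}) + h"
    by blast
  have "vec.subspace B"
    using B(1) by (simp add: galois_closed_def)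
  then have "vec.dim ((*v) H ` B) \<le> h"
    using dim_image_kernel[of B H] B(2,3) by linarith
  then obtain W where W: "vec.subspace W" "vec.dim W = h" "(*v) H ` B \<subseteq> W"
    using exists_superspace_dim h by metis
  obtain T :: "('f^'n) set" where T: "vec.independent T" "vec.span (ext_vec ` T) = B" "card T = vec.dim B"
    using galois_closed_rational_basis B(1) by metis
  have "T \<subseteq> {l. H *v ext_vec l \<in> W}"
    using W(3) T(2) vec.span_superset[of "ext_vec ` T"] by blast
  then have "card T \<le> vec.dim {l. H *v ext_vec l \<in> W}"
    using T(1) vec.independent_card_le_dim by blast
  then have "s \<le> base_dim \<iota> (U \<inter> W)"
    using base_dim_image_Int[of H W] dimU T(3) B(2) by (simp add: U_def)
  then show "\<not> evasive \<iota> h (int s - 1) U"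
    using W(1,2) by (force simp: evasive_def)
qed

text \<open>The change of coordinates is absorbed into \<open>H = transpose M ** G\<close>; being
  invertible, it leaves the kernel of \<open>G\<close> unchanged, and that is the dual of the row
  span.\<close>

lemma associated_system_rows:
  fixes C :: "('a^'n) set" and U :: "('a^'k) set"
  assumes "associated_system \<iota> C U"
  obtains H :: "'a^'n^'k"
  where "U = range (\<lambda>l. H *v ext_vec l)" "{x. H *v x = 0} = dual_code C"
proof -
  obtain G :: "'a^'n^'k" and M :: "'a^'k^'k" where G: "vec.span (rows G) = C" and M: "invertible M"
      and U: "U = (\<lambda>u. u v* M) ` base_span \<iota> (columns G)"
    using assms by (auto simp: associated_system_def generator_matrix_def)
  have vM: "u v* M = transpose M *v u" for u
    by (metis transpose_transpose vector_transpose_matrix)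
  have "{x. (transpose M ** G) *v x = 0} = dual_code C"
  proof -
    obtain N where "M ** N = mat 1"
      using M by (auto simp: invertible_def)
    then have "y = 0" if "y v* M = 0" for y
      using that vector_matrix_mul_assoc[of y M N] by simp
    then have "transpose M *v y = 0 \<longleftrightarrow> y = 0" for y
      by (metis vM matrix_vector_mult_0_right)
    then have "{x. (transpose M ** G) *v x = 0} = {x. G *v x = 0}"
      by (simp flip: matrix_vector_mul_assoc)
    also have "\<dots> = dual_code C"
      using G by (metis dual_code_rows dual_code_span)
    finally show ?thesis .
  qed
  moreover have "U = range (\<lambda>l. (transpose M ** G) *v ext_vec l)"
    unfolding U base_span_columns image_image vM matrix_vector_mul_assoc ..
  ultimately show ?thesis
    using that by blast
qed

end

section \<open>Comparing the system, the code and its dual\<close>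

theorem theorem3p3:
  fixes \<iota> :: "'f::{field,finite} \<Rightarrow> 'a::{field,finite}"
    and C :: "('a^'n) set"
    and U :: "('a^'k) set"
    and q m n k h r :: nat
  assumes "field_embedding \<iota>"
    and "CARD('f) = q" and "m > 0" and "CARD('a) = q ^ m"
    and "CARD('n) = n" and "CARD('k) = k" and "k \<le> n"
    and "linear_code k C" and "nondegenerate \<iota> TYPE('k) C"
    and "rank_system \<iota> n U" and "associated_system \<iota> C U"
    and "h < k" and "h \<le> r" and "int r \<le> int n - int k + int h - 1"
  shows
    "(evasive \<iota> h (int r) U \<longleftrightarrow> gen_rank_weight q (k - h) C \<ge> n - r) \<and>
     (gen_rank_weight q (k - h) C \<ge> n - r \<longleftrightarrow>
        gen_rank_weight q (r - h + 1) (dual_code C) \<ge> r + 2) \<and>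
     (gen_rank_weight q (k - h) C = n - r \<longleftrightarrow>
        evasive \<iota> h (int r) U \<and> \<not> evasive \<iota> h (int r - 1) U) \<and>
     (evasive \<iota> h (int r) U \<and> \<not> evasive \<iota> h (int r - 1) U \<longleftrightarrow>
        gen_rank_weight q (r - h + 1) (dual_code C) \<ge> r + 2 \<and>
        r + 2 \<ge> gen_rank_weight q (r - h) (dual_code C) + 2)"
proof -
  interpret finite_field_embedding \<iota>
    using assms(1) by (simp add: finite_field_embedding_def)
  note q = assms(2)[symmetric] and n = assms(5)[symmetric] and k = assms(6)[symmetric]
  have C: "vec.subspace C" "vec.dim C = k"
    using assms(8) by (simp_all add: linear_code_def)
  have dimdual: "vec.dim (dual_code C) = n - k"
    using dim_dual_code[of C] C(2) n by simp
  obtain H :: "'a^'n^'k" where H: "U = range (\<lambda>l. H *v ext_vec l)" "{x. H *v x = 0} = dual_code C"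
    using associated_system_rows[OF assms(11)] by metis
  have dimU: "base_dim \<iota> U = CARD('n)"
    using assms(10) n by (simp add: rank_system_def)
  \<comment> \<open>The obstruction to evasiveness, with the kernel of \<open>H\<close> read as the
    dual code.\<close>
  let ?Q = "\<lambda>s B. galois_closed q B \<and> vec.dim B = s \<and> s \<le> vec.dim (B \<inter> dual_code C) + h"
  have evasive: "evasive \<iota> h (int s - 1) U \<longleftrightarrow> \<not> (\<exists>B. ?Q s B)" for s
    using not_evasive_iff[of H h s] dimU assms(6,12) by (auto simp: H q)

  \<comment> \<open>Duality exchanges the \<open>B\<close> with \<open>?Q s B\<close> and the
    \<open>A\<close> of dimension \<open>n - s\<close> that meet \<open>C\<close> in dimension at
    least \<open>k - h\<close>; \<open>s \<le> n\<close> keeps \<open>n - s\<close> from being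
    truncated.\<close>
  have weight: "evasive \<iota> h (int s - 1) U \<longleftrightarrow> n - s < gen_rank_weight q (k - h) C"
    if "s \<le> n" for s
  proof -
    have flip: "galois_closed q (dual_code A)" "vec.dim (dual_code A) = n - vec.dim A"
        "vec.dim (dual_code A \<inter> C) + vec.dim A = vec.dim (A \<inter> dual_code C) + k"
        "dual_code (dual_code A) = A"
      if "galois_closed q A" for A :: "('a^'n) set"
      using that galois_closed_dual_code dim_dual_code[of A] dim_dual_code_Int[OF _ C(1)]
        dual_dual_code[of A] C(2) n q by (auto simp: galois_closed_def)
    have "(\<exists>B. ?Q s B) \<longleftrightarrow>
        (\<exists>A. galois_closed q A \<and> vec.dim A = n - s \<and> k - h \<le> vec.dim (A \<inter> C))"
    proof
      assume "\<exists>B. ?Q s B"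
      then obtain B where B: "?Q s B" ..
      then have "k - h \<le> vec.dim (dual_code B \<inter> C)"
        using flip(3)[of B] by linarith
      with B flip(1,2) show "\<exists>A. galois_closed q A \<and> vec.dim A = n - s \<and> k - h \<le> vec.dim (A \<inter> C)"
        by metis
    next
      assume "\<exists>A. galois_closed q A \<and> vec.dim A = n - s \<and> k - h \<le> vec.dim (A \<inter> C)"
      then obtain A where A: "galois_closed q A" "vec.dim A = n - s" "k - h \<le> vec.dim (A \<inter> C)"
        by blast
      have "vec.dim (dual_code A) = s"
        using flip(2)[OF A(1)] A(2) that by simp
      moreover have "s \<le> vec.dim (dual_code A \<inter> dual_code C) + h"
        \<comment> \<open>The dimension identity is used for \<open>dual_code A\<close>, whose dual
          is \<open>A\<close> again.\<close>
        using flip(3)[OF flip(1)[OF A(1)]] A(3) calculation by (simp add: flip(4)[OF A(1)])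
      ultimately show "\<exists>B. ?Q s B"
        using flip(1)[OF A(1)] by blast
    qed
    then show ?thesis
      using evasive[of s] less_gen_rank_weight_iff[of "k - h" C "n - s"] assms(12) C(2)
      by (simp add: q n)
  qed
  \<comment> \<open>For \<open>h < s\<close> the condition in \<open>?Q\<close> reads
    \<open>s - h \<le> vec.dim (B \<inter> dual_code C)\<close>; the second bound keeps the index
    \<open>s - h\<close> within the dimension of the dual code.\<close>
  have dual_weight: "evasive \<iota> h (int s - 1) U \<longleftrightarrow> s < gen_rank_weight q (s - h) (dual_code C)"
    if "h < s" "s - h \<le> n - k" "s \<le> n" for s
    using evasive[of s] less_gen_rank_weight_iff[of "s - h" "dual_code C" s] that dimdual
    by (simp add: q n le_diff_conv)
  have rn: "r + 1 \<le> n" "r + 1 - h \<le> n - k"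
    using assms(7,12,13,14) by linarith+
  \<comment> \<open>At \<open>s = r + 1\<close> the strict bounds above \<open>n - (r + 1)\<close>
    and \<open>r + 1\<close> become weak bounds by \<open>n - r\<close> and
    \<open>r + 2\<close>.\<close>
  have r: "evasive \<iota> h (int r) U \<longleftrightarrow> n - r \<le> gen_rank_weight q (k - h) C"
      "evasive \<iota> h (int r) U \<longleftrightarrow> r + 2 \<le> gen_rank_weight q (r - h + 1) (dual_code C)"
    using weight[of "r + 1"] dual_weight[of "r + 1"] rn assms(13)
    by (simp_all add: Suc_diff_le Suc_le_eq) linarith
  have r1: "evasive \<iota> h (int r - 1) U \<longleftrightarrow> n - r < gen_rank_weight q (k - h) C"
    using weight[of r] rn by simp
  have "evasive \<iota> h (int r - 1) U \<longleftrightarrow> r < gen_rank_weight q (r - h) (dual_code C)"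
  proof (cases "h = r")
    \<comment> \<open>The index is \<open>0\<close>, outside the reach of
      \<open>dual_weight\<close>. The right side is false by the convention; the left is false
      because for \<open>h = r\<close> every Galois closed \<open>B\<close> of dimension
      \<open>r\<close> is an obstruction.\<close>
    case True
    have "galois_closed q ({0} :: ('a^'n) set)"
      using galois_closed_span_ext_vec[of "{}"] by (simp add: q)
    then obtain B :: "('a^'n) set" where "galois_closed q B" "vec.dim B = r"
      using exists_galois_closed_superspace_dim[of "{0} :: ('a^'n) set" r] rn by (auto simp: q n)
    then show ?thesis
      using evasive[of r] True by (auto simp: gen_rank_weight_def)
  next
    case False
    then show ?thesis
      using dual_weight[of r] rn assms(13) by simp
  qed
  \<comment> \<open>Equality with \<open>n - r\<close> is the weak bound without the strict one; the
    last inequality of the statement negates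
    \<open>r < gen_rank_weight q (r - h) (dual_code C)\<close>.\<close>
  with r r1 show ?thesis by auto
qed

end
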